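(* Let $c,d\in\mathbb{R}$ and let $x:I\to\mathbb{C}$ ($I\subset\mathbb{R}$ an open interval) be a self-similar solution of the inverse mean curvature flow moving by scaling and rotation with scaling speed $d$ and rotation speed $c$. Then for every $\mathbf S>0$ and every $\mathbf R\in\mathbb{R}$, the rotated and scaled curve $\bar x=\mathbf S e^{i\mathbf R}x$ is also a self-similar solution with the same scaling speed $d$ and rotation speed $c$.
   Context: $\mathbb{R}^2$ is identified with $\mathbb{C}$, with Euclidean inner product $\langle z,w\rangle=\mathrm{Re}(z\bar w)$. For a smooth regular curve with nowhere vanishing curvature, $T$ is the unit tangent, $N=iT$, and $k=\langle dT/ds,N\rangle$ is the signed curvature, where $s$ is arc length. A family of curves is a solution of the inverse mean curvature flow if the normal component of its velocity with respect to $N$ is $-1/k$. A curve $x$ is called a self-similar solution with scaling (expanding) speed $d$ and rotation speed $c$ if it satisfies $c\langle x,T\rangle-d\langle x,N\rangle=\frac1k$ at every point; equivalently, the family $e^{(d-ci)t}x$ is a solution of the inverse mean curvature flow. In the equation for $\bar x$, the quantities $T,N,k$ are those of $\bar x$. *)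

theory Defs
  imports "HOL-Analysis.Analysis"
begin

text \<open>
  Curves are total functions \<open>real \<Rightarrow> complex\<close> considered on an open interval \<open>I\<close>; since \<open>I\<close> is open,
  derivatives at points of \<open>I\<close> do not depend on the values outside \<open>I\<close>.
\<close>

lemma inner_complex_eq_Re_cnj: "z \<bullet> w = Re (z * cnj w)" for z w :: complex
  by (simp add: inner_complex_def)

definition velocity :: "(real \<Rightarrow> complex) \<Rightarrow> real \<Rightarrow> complex"
  where "velocity x t = vector_derivative x (at t)"

definition unit_tangent :: "(real \<Rightarrow> complex) \<Rightarrow> real \<Rightarrow> complex"
  where "unit_tangent x t = velocity x t /\<^sub>R norm (velocity x t)"

definition unit_normal :: "(real \<Rightarrow> complex) \<Rightarrow> real \<Rightarrow> complex"
  where "unit_normal x t = \<i> * unit_tangent x t"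

text \<open>The derivative with respect to arc length \<open>s\<close> is \<open>d/ds = (1 / \<bar>x'\<bar>) d/dt\<close>, as \<open>ds/dt = \<bar>x'\<bar>\<close>.\<close>

definition arclength_deriv :: "(real \<Rightarrow> complex) \<Rightarrow> (real \<Rightarrow> complex) \<Rightarrow> real \<Rightarrow> complex"
  where "arclength_deriv x f t = vector_derivative f (at t) /\<^sub>R norm (velocity x t)"

definition signed_curvature :: "(real \<Rightarrow> complex) \<Rightarrow> real \<Rightarrow> real"
  where "signed_curvature x t = arclength_deriv x (unit_tangent x) t \<bullet> unit_normal x t"

text \<open>Derivatives of all orders exist at every point of \<open>I\<close>; iterating \<^const>\<open>velocity\<close> \<open>n\<close> times
  gives the \<open>n\<close>-th derivative.\<close>

definition smooth_curve_on :: "real set \<Rightarrow> (real \<Rightarrow> complex) \<Rightarrow> bool"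
  where "smooth_curve_on I x \<longleftrightarrow> (\<forall>n. \<forall>t\<in>I. (velocity ^^ n) x differentiable at t)"

definition regular_curve_on :: "real set \<Rightarrow> (real \<Rightarrow> complex) \<Rightarrow> bool"
  where "regular_curve_on I x \<longleftrightarrow> smooth_curve_on I x \<and> (\<forall>t\<in>I. velocity x t \<noteq> 0)"

text \<open>The equation says that the family \<open>exp ((d - c \<i>) \<tau>) * x\<close> has normal velocity \<open>-1/k\<close>: at
  \<open>\<tau> = 0\<close> the normal component of its velocity is \<open>d (x \<bullet> N) - c (x \<bullet> T)\<close>.\<close>

definition imcf_self_similar :: "real \<Rightarrow> real \<Rightarrow> real set \<Rightarrow> (real \<Rightarrow> complex) \<Rightarrow> bool"
  where "imcf_self_similar d c I x \<longleftrightarrow>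
    regular_curve_on I x \<and>
    (\<forall>t\<in>I. signed_curvature x t \<noteq> 0) \<and>
    (\<forall>t\<in>I. c * (x t \<bullet> unit_tangent x t) - d * (x t \<bullet> unit_normal x t) = 1 / signed_curvature x t)"

end

theory Submission
  imports Defs
begin

text \<open>
  Multiplication by a complex number \<open>a \<noteq> 0\<close> is a similarity of the plane: it rotates by
  \<open>sgn a\<close> and scales lengths by \<open>\<bar>a\<bar>\<close>. Hence it turns the frame \<open>(T, N)\<close> of a curve into
  \<open>(sgn a * T, sgn a * N)\<close> (\<open>unit_tangent_mult\<close>, \<open>unit_normal_mult\<close>) and divides the curvature
  by \<open>\<bar>a\<bar>\<close> (\<open>signed_curvature_mult\<close>). Both sides of the equation
  \<open>c \<langle>x, T\<rangle> - d \<langle>x, N\<rangle> = 1 / k\<close> are therefore multiplied by \<open>\<bar>a\<bar>\<close>: it is homogeneous of degree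
  one in the length scale and invariant under rotation. So it holds with the same \<open>c\<close> and \<open>d\<close> for
  \<open>a * x\<close>, and the theorem is the case \<open>a = S * exp (\<i> * R)\<close>.

  The remaining work is differentiability: \<^const>\<open>vector_derivative\<close> has an unspecified value at a
  point where the function is not differentiable, so it commutes with \<open>a * _\<close> only where a
  derivative is known to exist. Smoothness and regularity of \<open>x\<close> supply this for every iterated
  velocity and for the unit tangent.
\<close>

lemma inner_mult_common_factor: "(a * z) \<bullet> (a * w) = (norm a)\<^sup>2 * (z \<bullet> w)" for a z w :: complex
  unfolding cmod_power2 by (simp add: inner_complex_def power2_eq_square algebra_simps)

lemma velocity_mult:
  assumes "f differentiable at t"
  shows "velocity (\<lambda>s. a * f s) t = a * velocity f t"
  unfolding velocity_def
  by (intro vector_derivative_at has_vector_derivative_mult_right)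
     (use assms in \<open>simp add: vector_derivative_works\<close>)

lemma velocity_cong_open:
  assumes "open I" "t \<in> I" "\<And>s. s \<in> I \<Longrightarrow> f s = g s"
  shows "velocity f t = velocity g t"
  unfolding velocity_def
  by (rule vector_derivative_cong_eq)
     (use assms in \<open>auto simp: eventually_nhds\<close>)

lemma differentiable_cong_open:
  assumes "f differentiable at t" "open I" "t \<in> I" "\<And>s. s \<in> I \<Longrightarrow> f s = g s"
  shows "g differentiable at t"
  using assms unfolding differentiable_def
  by (metis has_derivative_transform_within_open)

text \<open>
  The equality is needed on the whole of \<open>I\<close> rather than at one point, since the next velocity
  depends on the values in a neighbourhood.
\<close>

lemma iterated_velocity_mult:
  assumes "open I" "smooth_curve_on I x" "t \<in> I"
  shows "(velocity ^^ n) (\<lambda>s. a * x s) t = a * (velocity ^^ n) x t"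
  using \<open>t \<in> I\<close>
proof (induction n arbitrary: t)
  case (Suc n)
  have "velocity ((velocity ^^ n) (\<lambda>s. a * x s)) t = velocity (\<lambda>s. a * (velocity ^^ n) x s) t"
    using assms(1) Suc by (intro velocity_cong_open)
  also have "\<dots> = a * velocity ((velocity ^^ n) x) t"
    using assms(2) Suc.prems by (intro velocity_mult) (simp add: smooth_curve_on_def)
  finally show ?case by simp
qed simp

lemma smooth_curve_on_mult:
  assumes "open I" "smooth_curve_on I x"
  shows "smooth_curve_on I (\<lambda>s. a * x s)"
  unfolding smooth_curve_on_def
proof (intro allI ballI)
  fix n t assume "t \<in> I"
  then have "(\<lambda>s. a * (velocity ^^ n) x s) differentiable at t"
    using assms(2) by (intro differentiable_mult) (simp_all add: smooth_curve_on_def)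
  then show "(velocity ^^ n) (\<lambda>s. a * x s) differentiable at t"
    using assms(1) \<open>t \<in> I\<close>
    by (rule differentiable_cong_open) (rule iterated_velocity_mult[OF assms, symmetric])
qed

lemma velocity_mult_on:
  assumes "smooth_curve_on I x" "t \<in> I"
  shows "velocity (\<lambda>s. a * x s) t = a * velocity x t"
  using assms by (metis velocity_mult smooth_curve_on_def funpow_0)

lemma regular_curve_on_mult:
  assumes "open I" "regular_curve_on I x" "a \<noteq> 0"
  shows "regular_curve_on I (\<lambda>s. a * x s)"
  using assms by (simp add: regular_curve_on_def smooth_curve_on_mult velocity_mult_on[of I])

lemma unit_tangent_mult:
  assumes "regular_curve_on I x" "t \<in> I"
  shows "unit_tangent (\<lambda>s. a * x s) t = sgn a * unit_tangent x t"
  using assms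
  by (simp add: unit_tangent_def regular_curve_on_def velocity_mult_on[of I] norm_mult sgn_div_norm)

lemma unit_normal_mult:
  assumes "regular_curve_on I x" "t \<in> I"
  shows "unit_normal (\<lambda>s. a * x s) t = sgn a * unit_normal x t"
  using assms by (simp add: unit_normal_def unit_tangent_mult[of I])

text \<open>Regularity is what makes this work: the norm is differentiable away from the origin only.\<close>

lemma unit_tangent_differentiable:
  assumes "regular_curve_on I x" "t \<in> I"
  shows "unit_tangent x differentiable at t"
proof -
  have v: "velocity x differentiable at t" "velocity x t \<noteq> 0"
    using assms by (auto simp: regular_curve_on_def smooth_curve_on_def dest!: spec[of _ 1])
  have "(\<lambda>s. norm (velocity x s)) differentiable at t"
    using differentiable_compose[OF differentiable_norm_at v(1)] v(2) by simp
  then have "(\<lambda>s. velocity x s /\<^sub>R norm (velocity x s)) differentiable at t"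
    using v by (intro differentiable_scaleR differentiable_inverse) simp_all
  then show ?thesis
    by (simp add: unit_tangent_def[abs_def])
qed

text \<open>
  The derivative of the unit tangent in the parameter and the unit normal both pick up the factor
  \<open>sgn a\<close>, which the inner product does not see; the factor \<open>1 / \<bar>a\<bar>\<close> comes from arc length
  alone.
\<close>

lemma signed_curvature_mult:
  assumes "open I" "regular_curve_on I x" "t \<in> I" "a \<noteq> 0"
  shows "signed_curvature (\<lambda>s. a * x s) t = signed_curvature x t / norm a"
proof -
  have "velocity (unit_tangent (\<lambda>s. a * x s)) t = velocity (\<lambda>s. sgn a * unit_tangent x s) t"
    using assms by (intro velocity_cong_open[of I]) (auto simp: unit_tangent_mult[of I])
  also have "\<dots> = sgn a * velocity (unit_tangent x) t"
    using assms by (intro velocity_mult unit_tangent_differentiable)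
  finally have dT: "vector_derivative (unit_tangent (\<lambda>s. a * x s)) (at t)
      = sgn a * vector_derivative (unit_tangent x) (at t)"
    by (simp add: velocity_def)
  have "velocity (\<lambda>s. a * x s) t = a * velocity x t"
    using assms by (intro velocity_mult_on) (auto simp: regular_curve_on_def)
  then show ?thesis
    using assms
    by (simp add: signed_curvature_def arclength_deriv_def dT unit_normal_mult[of I] norm_mult
        inner_mult_common_factor norm_sgn divide_simps)
qed

lemma imcf_self_similar_mult:
  assumes "open I" "imcf_self_similar d c I x" "a \<noteq> 0"
  shows "imcf_self_similar d c I (\<lambda>s. a * x s)"
proof -
  have reg: "regular_curve_on I x"
    using assms(2) by (simp add: imcf_self_similar_def)
  \<comment> \<open>Splitting \<open>a = \<bar>a\<bar> * sgn a\<close> leaves the same unit rotation in both arguments, where it cancels.\<close>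
  have inner: "(a * z) \<bullet> (sgn a * w) = norm a * (z \<bullet> w)" for z w
  proof -
    have "(a * z) \<bullet> (sgn a * w) = (norm a *\<^sub>R (sgn a * z)) \<bullet> (sgn a * w)"
      using \<open>a \<noteq> 0\<close> by (simp add: sgn_div_norm)
    then show ?thesis
      using \<open>a \<noteq> 0\<close> by (simp only: inner_scaleR_left inner_mult_common_factor) (simp add: norm_sgn)
  qed
  have "c * ((a * x t) \<bullet> unit_tangent (\<lambda>s. a * x s) t) - d * ((a * x t) \<bullet> unit_normal (\<lambda>s. a * x s) t)
      = 1 / signed_curvature (\<lambda>s. a * x s) t" if "t \<in> I" for t
  proof -
    have "c * ((a * x t) \<bullet> unit_tangent (\<lambda>s. a * x s) t) - d * ((a * x t) \<bullet> unit_normal (\<lambda>s. a * x s) t)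
        = norm a * (c * (x t \<bullet> unit_tangent x t) - d * (x t \<bullet> unit_normal x t))"
      using reg that by (simp add: unit_tangent_mult[of I] unit_normal_mult[of I] inner algebra_simps)
    also have "\<dots> = norm a * (1 / signed_curvature x t)"
      using assms(2) that by (simp add: imcf_self_similar_def)
    also have "\<dots> = 1 / signed_curvature (\<lambda>s. a * x s) t"
      using assms reg that by (simp add: signed_curvature_mult[of I])
    finally show ?thesis .
  qed
  moreover have "signed_curvature (\<lambda>s. a * x s) t \<noteq> 0" if "t \<in> I" for t
    using assms reg that by (simp add: signed_curvature_mult[of I] imcf_self_similar_def)
  ultimately show ?thesis
    using assms reg by (simp add: imcf_self_similar_def regular_curve_on_mult)
qed

theorem proposition1p2:
  fixes c d :: real and I :: "real set" and x :: "real \<Rightarrow> complex"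
  assumes "open I" and "is_interval I" and "I \<noteq> {}"
    and "imcf_self_similar d c I x"
  shows "\<forall>S R :: real. S > 0 \<longrightarrow>
    imcf_self_similar d c I (\<lambda>t. complex_of_real S * exp (\<i> * complex_of_real R) * x t)"
  using assms by (intro allI impI imcf_self_similar_mult) simp_all

end
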